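(* Every surjective word in any finitely generated free group is weakly profinitely rigid.
   Context: Let $F_n$ be the free group on $n$ generators. For $w\in F_n$ and a group $G$, $G_w=\{w(g_1,\dots,g_n)\mid g_1,\dots,g_n\in G\}$ is the image of the word map of $w$ on $G$ (substituting $g_i$ for the $i$-th generator). A word $w\in F_n$ is surjective if $G_w=G$ for every group $G$. Two elements $g,h$ of a group $H$ are endomorphic equivalent if there exist endomorphisms $\phi_1,\phi_2$ of $H$ (not necessarily distinct) with $\phi_1(g)=h$ and $\phi_2(h)=g$. A word $w\in F_n$ is weakly profinitely rigid if every $u\in F_n$ with $G_u=G_w$ for every finite group $G$ is endomorphic equivalent to $w$ in $F_n$. *)

theory Defs
  imports "HOL-Algebra.Algebra"
begin

section \<open>The free group on n generators\<close>

text \<open>The letter \<open>(i, True)\<close> is the generator \<open>x\<^sub>i\<close> and \<open>(i, False)\<close> is its formal inverse. The free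
  group is represented by reduced words, indexed by generators \<open>0, \<dots>, n - 1\<close>.\<close>

type_synonym letter = "nat \<times> bool"

definition letter_inv :: "letter \<Rightarrow> letter"
  where "letter_inv a = (fst a, \<not> snd a)"

definition reduced :: "letter list \<Rightarrow> bool"
  where "reduced w \<longleftrightarrow> successively (\<lambda>a b. b \<noteq> letter_inv a) w"

fun cancel_cons :: "letter \<Rightarrow> letter list \<Rightarrow> letter list" where
  "cancel_cons a [] = [a]"
| "cancel_cons a (b # w) = (if b = letter_inv a then w else a # b # w)"

definition reduce :: "letter list \<Rightarrow> letter list"
  where "reduce w = foldr cancel_cons w []"

definition free_group :: "nat \<Rightarrow> letter list monoid"
  where "free_group n =
    \<lparr>carrier = {w. reduced w \<and> fst ` set w \<subseteq> {..<n}},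
     monoid.mult = (\<lambda>u v. reduce (u @ v)),
     one = []\<rparr>"

definition free_gen :: "nat \<Rightarrow> letter list"
  where "free_gen i = [(i, True)]"

section \<open>Word maps\<close>

definition letter_eval :: "('g, 'm) monoid_scheme \<Rightarrow> (nat \<Rightarrow> 'g) \<Rightarrow> letter \<Rightarrow> 'g"
  where "letter_eval G g a = (if snd a then g (fst a) else inv\<^bsub>G\<^esub> (g (fst a)))"

definition word_eval :: "('g, 'm) monoid_scheme \<Rightarrow> (nat \<Rightarrow> 'g) \<Rightarrow> letter list \<Rightarrow> 'g"
  where "word_eval G g w = foldr (\<lambda>a x. letter_eval G g a \<otimes>\<^bsub>G\<^esub> x) w \<one>\<^bsub>G\<^esub>"

definition word_image :: "('g, 'm) monoid_scheme \<Rightarrow> nat \<Rightarrow> letter list \<Rightarrow> 'g set"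
  where "word_image G n w = {word_eval G g w | g. g \<in> {..<n} \<rightarrow> carrier G}"

section \<open>Surjective words, endomorphic equivalence, weak profinite rigidity\<close>

text \<open>HOL cannot quantify over all types inside a formula, so ``every group'' and ``every finite
  group'' range over the groups whose carrier is a set of natural numbers. No generality is lost:
  the lemmas \<open>surjective_word_iff\<close> and \<open>same_finite_word_images_iff\<close> below show that the
  corresponding conditions then hold for the (finite) groups over every type.\<close>

definition surjective_word :: "nat \<Rightarrow> letter list \<Rightarrow> bool"
  where "surjective_word n w \<longleftrightarrow>
    (\<forall>G :: nat monoid. group G \<longrightarrow> word_image G n w = carrier G)"

definition same_finite_word_images :: "nat \<Rightarrow> letter list \<Rightarrow> letter list \<Rightarrow> bool"
  where "same_finite_word_images n u w \<longleftrightarrow>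
    (\<forall>G :: nat monoid. group G \<and> finite (carrier G) \<longrightarrow> word_image G n u = word_image G n w)"

definition endomorphic_equivalent :: "('h, 'm) monoid_scheme \<Rightarrow> 'h \<Rightarrow> 'h \<Rightarrow> bool"
  where "endomorphic_equivalent H g h \<longleftrightarrow>
    (\<exists>\<phi>\<^sub>1 \<in> hom H H. \<exists>\<phi>\<^sub>2 \<in> hom H H. \<phi>\<^sub>1 g = h \<and> \<phi>\<^sub>2 h = g)"

definition weakly_profinitely_rigid :: "nat \<Rightarrow> letter list \<Rightarrow> bool"
  where "weakly_profinitely_rigid n w \<longleftrightarrow>
    (\<forall>u \<in> carrier (free_group n).
       same_finite_word_images n u w \<longrightarrow> endomorphic_equivalent (free_group n) u w)"

section \<open>The free group is a group with the expected universal property\<close>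

lemma letter_inv_simps [simp]:
  "letter_inv (letter_inv a) = a" "fst (letter_inv a) = fst a"
  "letter_inv a = letter_inv b \<longleftrightarrow> a = b" "letter_inv a \<noteq> a" "a \<noteq> letter_inv a"
  by (auto simp: letter_inv_def prod_eq_iff)

lemma reduced_simps [simp]:
  "reduced []" "reduced [a]"
  "reduced (a # b # w) \<longleftrightarrow> b \<noteq> letter_inv a \<and> reduced (b # w)"
  by (auto simp: reduced_def)

lemma reduced_tl: "reduced (a # w) \<Longrightarrow> reduced w"
  by (cases w) auto

lemma reduced_cancel_cons: "reduced w \<Longrightarrow> reduced (cancel_cons a w)"
  by (cases w) (auto dest: reduced_tl)

lemma cancel_cons_reduced: "reduced (a # w) \<Longrightarrow> cancel_cons a w = a # w"
  by (cases w) auto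

lemma cancel_cons_inverse:
  assumes "reduced w"
  shows "cancel_cons a (cancel_cons (letter_inv a) w) = w"
    and "cancel_cons (letter_inv a) (cancel_cons a w) = w"
proof -
  have "cancel_cons b (cancel_cons (letter_inv b) w) = w" for b
  proof (cases w)
    case (Cons c v)
    then show ?thesis
      using assms by (cases "c = b") (simp_all add: cancel_cons_reduced)
  qed simp
  from this[of a] this[of "letter_inv a"]
  show "cancel_cons a (cancel_cons (letter_inv a) w) = w"
    and "cancel_cons (letter_inv a) (cancel_cons a w) = w"
    by simp_all
qed

lemma reduced_foldr: "reduced w \<Longrightarrow> reduced (foldr cancel_cons v w)"
  by (induction v) (auto intro: reduced_cancel_cons)

lemma reduced_reduce: "reduced (reduce w)"
  by (simp add: reduce_def reduced_foldr)

lemma reduce_reduced: "reduced w \<Longrightarrow> reduce w = w"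
proof (induction w)
  case (Cons a w)
  then show ?case
    using reduced_tl[OF Cons.prems] by (simp add: reduce_def cancel_cons_reduced)
qed (simp add: reduce_def)

lemma reduce_append: "reduced v \<Longrightarrow> reduce (u @ v) = foldr cancel_cons u v"
  using reduce_reduced[of v] by (simp add: reduce_def)

lemma foldr_cancel_cons: 
  assumes "reduced w"
  shows "foldr cancel_cons (cancel_cons a v) w = cancel_cons a (foldr cancel_cons v w)"
  using assms cancel_cons_inverse(1)[OF reduced_foldr[OF assms]] by (cases v) auto

lemma foldr_cancel_assoc:
  "reduced w \<Longrightarrow> foldr cancel_cons (foldr cancel_cons u v) w = foldr cancel_cons u (foldr cancel_cons v w)"
  by (induction u) (auto simp: foldr_cancel_cons)

lemma set_cancel_cons: "set (cancel_cons a w) \<subseteq> insert a (set w)"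
  by (cases w) auto

lemma set_foldr_cancel: "set (foldr cancel_cons u v) \<subseteq> set u \<union> set v"
proof (induction u)
  case (Cons a u)
  then show ?case
    using set_cancel_cons[of a "foldr cancel_cons u v"] by auto
qed auto

lemma foldr_cancel_rev:
  "reduced w \<Longrightarrow> foldr cancel_cons (rev (map letter_inv u)) (foldr cancel_cons u w) = w"
  by (induction u arbitrary: w) (auto simp: cancel_cons_inverse reduced_foldr)

lemma reduced_rev_inv: "reduced u \<Longrightarrow> reduced (rev (map letter_inv u))"
  unfolding reduced_def by (simp add: successively_map) (erule successively_mono, auto)

lemma carrier_free_group: "w \<in> carrier (free_group n) \<longleftrightarrow> reduced w \<and> fst ` set w \<subseteq> {..<n}"
  by (simp add: free_group_def)

lemma one_free_group [simp]: "\<one>\<^bsub>free_group n\<^esub> = []"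
  by (simp add: free_group_def)

lemma mult_free_group:
  "v \<in> carrier (free_group n) \<Longrightarrow> u \<otimes>\<^bsub>free_group n\<^esub> v = foldr cancel_cons u v"
  by (simp add: free_group_def reduce_append)

lemma free_group_closed:
  assumes "u \<in> carrier (free_group n)" "v \<in> carrier (free_group n)"
  shows "u \<otimes>\<^bsub>free_group n\<^esub> v \<in> carrier (free_group n)"
proof -
  have "fst ` set (foldr cancel_cons u v) \<subseteq> fst ` (set u \<union> set v)"
    by (rule image_mono[OF set_foldr_cancel])
  also have "\<dots> \<subseteq> {..<n}"
    using assms by (simp add: image_Un carrier_free_group)
  finally show ?thesis
    using assms by (simp add: mult_free_group) (simp add: carrier_free_group reduced_foldr)
qed

lemma free_group_inverse:
  assumes "u \<in> carrier (free_group n)"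
  shows "rev (map letter_inv u) \<in> carrier (free_group n)"
    and "rev (map letter_inv u) \<otimes>\<^bsub>free_group n\<^esub> u = []"
  using assms foldr_cancel_rev[of "[]" u] reduce_reduced[of u]
  by (auto simp: mult_free_group carrier_free_group reduced_rev_inv reduce_def image_image)

lemma group_free_group: "group (free_group n)"
proof (rule groupI)
  fix x y z
  assume xyz: "x \<in> carrier (free_group n)" "y \<in> carrier (free_group n)" "z \<in> carrier (free_group n)"
  have "y \<otimes>\<^bsub>free_group n\<^esub> z \<in> carrier (free_group n)"
    using xyz by (simp add: free_group_closed)
  then show "x \<otimes>\<^bsub>free_group n\<^esub> y \<otimes>\<^bsub>free_group n\<^esub> z = x \<otimes>\<^bsub>free_group n\<^esub> (y \<otimes>\<^bsub>free_group n\<^esub> z)"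
    using xyz foldr_cancel_assoc[of z x y] by (simp add: mult_free_group carrier_free_group)
next
  fix x assume "x \<in> carrier (free_group n)"
  then show "\<exists>y\<in>carrier (free_group n). y \<otimes>\<^bsub>free_group n\<^esub> x = \<one>\<^bsub>free_group n\<^esub>"
    using free_group_inverse[of x n] by auto
next
  show "\<one>\<^bsub>free_group n\<^esub> \<in> carrier (free_group n)"
    by (simp add: carrier_free_group)
next
  fix x y assume "x \<in> carrier (free_group n)" "y \<in> carrier (free_group n)"
  then show "x \<otimes>\<^bsub>free_group n\<^esub> y \<in> carrier (free_group n)"
    by (rule free_group_closed)
qed (simp add: mult_free_group)

lemma inv_free_group:
  "u \<in> carrier (free_group n) \<Longrightarrow> inv\<^bsub>free_group n\<^esub> u = rev (map letter_inv u)"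
  by (rule group.inv_equality[OF group_free_group]) (auto simp: free_group_inverse)

lemma free_gen_closed: "i < n \<Longrightarrow> free_gen i \<in> carrier (free_group n)"
  by (simp add: free_gen_def carrier_free_group)

lemma word_eval_simps [simp]:
  "word_eval G g [] = \<one>\<^bsub>G\<^esub>"
  "word_eval G g (a # w) = letter_eval G g a \<otimes>\<^bsub>G\<^esub> word_eval G g w"
  by (simp_all add: word_eval_def)

lemma letter_eval_closed:
  assumes "group G" "g \<in> {..<n} \<rightarrow> carrier G" "fst a < n"
  shows "letter_eval G g a \<in> carrier G"
  using assms by (auto simp: letter_eval_def intro!: group.inv_closed)

lemma word_eval_closed:
  assumes "group G" "g \<in> {..<n} \<rightarrow> carrier G" "fst ` set w \<subseteq> {..<n}"
  shows "word_eval G g w \<in> carrier G"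
  using assms(3)
  by (induction w)
    (auto simp: letter_eval_closed[OF assms(1,2)] group.is_monoid[OF assms(1)]
       intro!: monoid.one_closed monoid.m_closed)

lemma word_eval_cancel_cons:
  assumes G: "group G" and g: "g \<in> {..<n} \<rightarrow> carrier G" and a: "fst a < n"
    and w: "fst ` set w \<subseteq> {..<n}"
  shows "word_eval G g (cancel_cons a w) = letter_eval G g a \<otimes>\<^bsub>G\<^esub> word_eval G g w"
proof (cases w)
  case (Cons b v)
  interpret group G by (rule G)
  show ?thesis
  proof (cases "b = letter_inv a")
    case True
    have "word_eval G g v \<in> carrier G"
      using word_eval_closed[OF G g] w Cons by auto
    moreover have "g (fst a) \<in> carrier G"
      using g a by auto
    ultimately show ?thesis
      using True Cons by (auto simp: letter_eval_def letter_inv_def simp flip: m_assoc)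
  qed (use Cons in auto)
qed auto

lemma word_eval_mult:
  assumes G: "group G" and g: "g \<in> {..<n} \<rightarrow> carrier G"
    and u: "fst ` set u \<subseteq> {..<n}" and v: "fst ` set v \<subseteq> {..<n}"
  shows "word_eval G g (foldr cancel_cons u v) = word_eval G g u \<otimes>\<^bsub>G\<^esub> word_eval G g v"
  using u
proof (induction u)
  case Nil
  then show ?case
    using word_eval_closed[OF G g v] G by (simp add: group.is_monoid)
next
  case (Cons a u)
  interpret group G by (rule G)
  have "fst ` set (foldr cancel_cons u v) \<subseteq> {..<n}"
    using set_foldr_cancel[of u v] Cons.prems v by fastforce
  then show ?case
    using Cons word_eval_cancel_cons[OF G g, of a "foldr cancel_cons u v"]
      letter_eval_closed[OF G g, of a] word_eval_closed[OF G g, of u] word_eval_closed[OF G g v]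
    by (simp add: m_assoc)
qed

lemma word_eval_hom:
  assumes "group G" "g \<in> {..<n} \<rightarrow> carrier G"
  shows "word_eval G g \<in> hom (free_group n) G"
  using word_eval_closed[OF assms] word_eval_mult[OF assms]
  by (intro homI) (simp_all add: mult_free_group carrier_free_group)

lemma word_eval_gen:
  assumes "group G" "g \<in> {..<n} \<rightarrow> carrier G" "i < n"
  shows "word_eval G g (free_gen i) = g i"
  using assms by (auto simp: free_gen_def letter_eval_def group.is_monoid intro!: monoid.r_one)

lemma hom_word_eval:
  assumes G: "group G" and H: "group H" and h: "h \<in> hom G H"
    and g: "g \<in> {..<n} \<rightarrow> carrier G" and w: "fst ` set w \<subseteq> {..<n}"
  shows "h (word_eval G g w) = word_eval H (h \<circ> g) w"
  using w
proof (induction w)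
  case Nil
  then show ?case
    using hom_one[OF h G H] by simp
next
  case (Cons a w)
  interpret group_hom G H h
    using G H h by (simp add: group_hom_def group_hom_axioms_def)
  have "g (fst a) \<in> carrier G"
    using g Cons.prems by auto
  then have "h (letter_eval G g a) = letter_eval H (h \<circ> g) a"
    by (simp add: letter_eval_def)
  then show ?case
    using Cons letter_eval_closed[OF G g, of a] word_eval_closed[OF G g, of w]
    by (simp del: comp_apply)
qed

lemma word_eval_free_gen:
  assumes "w \<in> carrier (free_group n)"
  shows "word_eval (free_group n) free_gen w = w"
proof -
  have "reduced w \<Longrightarrow> fst ` set w \<subseteq> {..<n} \<Longrightarrow> word_eval (free_group n) free_gen w = w"
  proof (induction w)
    case (Cons a w)
    then have w: "w \<in> carrier (free_group n)" "word_eval (free_group n) free_gen w = w"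
      by (auto simp: carrier_free_group dest: reduced_tl)
    have "letter_eval (free_group n) free_gen a = [a]"
      using Cons.prems inv_free_group[OF free_gen_closed, of "fst a" n]
      by (auto simp: letter_eval_def free_gen_def letter_inv_def prod_eq_iff)
    then show ?case
      using Cons.prems w by (simp add: mult_free_group cancel_cons_reduced)
  qed simp
  then show ?thesis
    using assms by (simp add: carrier_free_group)
qed

lemma free_group_hom_unique:
  assumes "group G" "h \<in> hom (free_group n) G" "w \<in> carrier (free_group n)"
  shows "h w = word_eval G (h \<circ> free_gen) w"
proof -
  have "free_gen \<in> {..<n} \<rightarrow> carrier (free_group n)"
    by (simp add: free_gen_closed)
  then show ?thesis
    using hom_word_eval[OF group_free_group assms(1,2), of free_gen n w] assms(3)
    by (simp add: word_eval_free_gen carrier_free_group)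
qed

section \<open>The quantification over groups with carrier in the natural numbers is general\<close>

lemma word_image_subset:
  assumes "group G" "w \<in> carrier (free_group n)"
  shows "word_image G n w \<subseteq> carrier G"
  using assms(2) word_eval_closed[OF assms(1)]
  by (auto simp only: word_image_def carrier_free_group mem_Collect_eq)

lemma hom_word_image:
  assumes G: "group G" and H: "group H" and h: "h \<in> hom G H" and w: "w \<in> carrier (free_group n)"
  shows "h ` word_image G n w \<subseteq> word_image H n w"
proof
  fix y assume "y \<in> h ` word_image G n w"
  then obtain g where g: "g \<in> {..<n} \<rightarrow> carrier G" and y: "y = h (word_eval G g w)"
    by (auto simp: word_image_def)
  have "y = word_eval H (h \<circ> g) w"
    using hom_word_eval[OF G H h g] w y by (simp add: carrier_free_group)
  moreover have "h \<circ> g \<in> {..<n} \<rightarrow> carrier H"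
    using g h by (auto simp: hom_def)
  ultimately show "y \<in> word_image H n w"
    unfolding word_image_def by blast
qed

lemma iso_word_image:
  assumes G: "group G" and H: "group H" and h: "h \<in> iso G H" and w: "w \<in> carrier (free_group n)"
  shows "word_image H n w = h ` word_image G n w"
proof
  let ?k = "inv_into (carrier G) h"
  have k: "?k \<in> iso H G"
    using group.iso_set_sym[OF G h] .
  have hk: "h (?k y) = y" if "y \<in> carrier H" for y
    using that h by (auto simp: iso_def bij_betw_def intro: f_inv_into_f)
  show "word_image H n w \<subseteq> h ` word_image G n w"
  proof
    fix y assume y: "y \<in> word_image H n w"
    then have "?k y \<in> word_image G n w"
      using hom_word_image[OF H G iso_imp_homomorphism[OF k] w] by auto
    moreover have "y = h (?k y)"
      using hk y word_image_subset[OF H w] by auto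
    ultimately show "y \<in> h ` word_image G n w"
      by blast
  qed
  show "h ` word_image G n w \<subseteq> word_image H n w"
    using hom_word_image[OF G H iso_imp_homomorphism[OF h] w] .
qed

lemma surjective_wordD:
  fixes G :: "('g, 'm) monoid_scheme"
  assumes w: "w \<in> carrier (free_group n)" and surj: "surjective_word n w" and G: "group G"
  shows "word_image G n w = carrier G"
proof
  show "word_image G n w \<subseteq> carrier G"
    using G w by (rule word_image_subset)
  show "carrier G \<subseteq> word_image G n w"
  proof
    fix x assume x: "x \<in> carrier G"
    obtain f :: "int \<Rightarrow> nat" where f: "inj f"
      using ex_inj by blast
    let ?Z = "image_group f integer_group"
    have Z: "group ?Z" and iso: "f \<in> iso integer_group ?Z"
      using f group.inj_imp_image_group_is_group[OF group_integer_group] inj_imp_image_group_iso[of f integer_group] by auto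
    have "word_image ?Z n w = carrier ?Z"
      using surj Z by (simp add: surjective_word_def)
    then have "f ` word_image integer_group n w = f ` UNIV"
      using iso_word_image[OF group_integer_group Z iso w] by (simp add: image_group_carrier)
    then have "(1::int) \<in> word_image integer_group n w"
      using inj_image_eq_iff[OF f] by simp
    then have "x [^]\<^bsub>G\<^esub> (1::int) \<in> word_image G n w"
      using hom_word_image[OF group_integer_group G group.hom_integer_group_pow[OF G x] w] by auto
    then show "x \<in> word_image G n w"
      using x G by (simp add: group.int_pow_1)
  qed
qed

lemma surjective_word_iff:
  assumes "infinite (UNIV :: 'g set)" and "w \<in> carrier (free_group n)"
  shows "surjective_word n w \<longleftrightarrow> (\<forall>G :: 'g monoid. group G \<longrightarrow> word_image G n w = carrier G)"
proof
  assume *: "\<forall>G :: 'g monoid. group G \<longrightarrow> word_image G n w = carrier G"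
  obtain f :: "nat \<Rightarrow> 'g" where f: "inj f"
    using infinite_countable_subset[OF assms(1)] by blast
  show "surjective_word n w"
    unfolding surjective_word_def
  proof (intro allI impI)
    fix G :: "nat monoid" assume G: "group G"
    have inj: "inj_on f (carrier G)"
      using f by (rule inj_on_subset) simp
    have H: "group (image_group f G)"
      using group.inj_imp_image_group_is_group[OF G inj] .
    have "f ` word_image G n w = f ` carrier G"
      using * H iso_word_image[OF G H inj_imp_image_group_iso[OF inj] assms(2)]
      by (simp add: image_group_carrier)
    then show "word_image G n w = carrier G"
      using f by (simp add: inj_image_eq_iff)
  qed
qed (simp add: surjective_wordD[OF assms(2)])

lemma same_finite_word_imagesD:
  fixes G :: "('g, 'm) monoid_scheme"
  assumes u: "u \<in> carrier (free_group n)" and w: "w \<in> carrier (free_group n)"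
    and same: "same_finite_word_images n u w" and G: "group G" and fin: "finite (carrier G)"
  shows "word_image G n u = word_image G n w"
proof -
  obtain f :: "'g \<Rightarrow> nat" where f: "inj_on f (carrier G)"
    using finite_imp_inj_to_nat_seg[OF fin] by blast
  have H: "group (image_group f G)" and iso: "f \<in> iso G (image_group f G)"
    using group.inj_imp_image_group_is_group[OF G f] inj_imp_image_group_iso[OF f] .
  have "f ` word_image G n u = f ` word_image G n w"
    using same H fin iso_word_image[OF G H iso u] iso_word_image[OF G H iso w]
    by (simp add: same_finite_word_images_def image_group_carrier)
  then show ?thesis
    using f word_image_subset[OF G u] word_image_subset[OF G w] by (simp add: inj_on_image_eq_iff)
qed

lemma same_finite_word_images_iff:
  assumes "infinite (UNIV :: 'g set)"
    and u: "u \<in> carrier (free_group n)" and w: "w \<in> carrier (free_group n)"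
  shows "same_finite_word_images n u w \<longleftrightarrow>
    (\<forall>G :: 'g monoid. group G \<and> finite (carrier G) \<longrightarrow> word_image G n u = word_image G n w)"
proof
  assume *: "\<forall>G :: 'g monoid. group G \<and> finite (carrier G) \<longrightarrow> word_image G n u = word_image G n w"
  obtain f :: "nat \<Rightarrow> 'g" where f: "inj f"
    using infinite_countable_subset[OF assms(1)] by blast
  show "same_finite_word_images n u w"
    unfolding same_finite_word_images_def
  proof (intro allI impI, elim conjE)
    fix G :: "nat monoid" assume G: "group G" and fin: "finite (carrier G)"
    have inj: "inj_on f (carrier G)"
      using f by (rule inj_on_subset) simp
    have H: "group (image_group f G)" and iso: "f \<in> iso G (image_group f G)"
      using group.inj_imp_image_group_is_group[OF G inj] inj_imp_image_group_iso[OF inj] .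
    have "f ` word_image G n u = f ` word_image G n w"
      using * H fin iso_word_image[OF G H iso u] iso_word_image[OF G H iso w]
      by (simp add: image_group_carrier)
    then show "word_image G n u = word_image G n w"
      using f by (simp add: inj_image_eq_iff)
  qed
qed (simp add: same_finite_word_imagesD[OF u w])

end

theory Submission
  imports Defs
begin

text \<open>The image of the word map of \<open>u\<close> on the integers is a subgroup \<open>A\<close>, since that map is linear.
  If \<open>u\<close> is surjective on every finite cyclic group, then \<open>A\<close> meets the residue class of 1 modulo every
  \<open>m > 0\<close>: with \<open>m = 2\<close> it contains some \<open>a \<noteq> 0\<close>, and with \<open>m = \<bar>a\<bar>\<close> it contains some
  \<open>1 + k a\<close>, hence 1. So \<open>u\<close> is surjective on every group. Two surjective words \<open>u\<close> and \<open>w\<close> are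
  endomorphic equivalent: evaluating one of them on the free group itself takes the other as a value,
  and the values of a word on the free group are its images under endomorphisms.\<close>

lemma word_eval_cong:
  assumes "\<And>i. i \<in> fst ` set u \<Longrightarrow> g i = h i"
  shows "word_eval G g u = word_eval G h u"
  using assms by (induction u) (simp_all add: letter_eval_def)

text \<open>Each letter contributes \<open>g i\<close> or \<open>- g i\<close>, so the value is the
  sum of the \<open>g i\<close> weighted by the exponent sums of \<open>u\<close>.\<close>

lemma word_eval_integer_group_linear:
  "word_eval integer_group (\<lambda>i. x * g i + y * h i) u =
    x * word_eval integer_group g u + y * word_eval integer_group h u"
proof (induction u)
  case (Cons a u)
  have "letter_eval integer_group (\<lambda>i. x * g i + y * h i) a =
      x * letter_eval integer_group g a + y * letter_eval integer_group h a"
    by (simp add: letter_eval_def)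
  then show ?case
    using Cons by (simp add: algebra_simps)
qed simp

lemma word_image_integer_group_linear:
  assumes "a \<in> word_image integer_group n u" "b \<in> word_image integer_group n u"
  shows "x * a + y * b \<in> word_image integer_group n u"
proof -
  obtain g h where "a = word_eval integer_group g u" "b = word_eval integer_group h u"
    using assms by (auto simp: word_image_def)
  then have "x * a + y * b = word_eval integer_group (\<lambda>i. x * g i + y * h i) u"
    by (simp add: word_eval_integer_group_linear)
  then show ?thesis
    by (auto simp: word_image_def)
qed

text \<open>Every \<open>x\<close> is the image of 1 under the homomorphism
  \<open>k \<mapsto> x [^] k\<close> from the integers, and homomorphisms send values of
  \<open>u\<close> to values of \<open>u\<close>.\<close>

lemma surjective_word_if_one_in_image:
  assumes u: "u \<in> carrier (free_group n)" and one: "1 \<in> word_image integer_group n u"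
  shows "surjective_word n u"
  unfolding surjective_word_def
proof (intro allI impI subset_antisym subsetI)
  fix G :: "nat monoid" and x
  assume G: "group G" and x: "x \<in> carrier G"
  have "x [^]\<^bsub>G\<^esub> (1::int) \<in> word_image G n u"
    using hom_word_image[OF group_integer_group G group.hom_integer_group_pow[OF G x] u] one by auto
  then show "x \<in> word_image G n u"
    using x G by (simp add: group.int_pow_1)
qed (use word_image_subset[OF _ u] in auto)

lemma word_image_integer_mod_group:
  assumes u: "u \<in> carrier (free_group n)" and m: "m > 0"
  shows "word_image (integer_mod_group m) n u = (\<lambda>a. a mod int m) ` word_image integer_group n u"
proof
  have hom: "(\<lambda>a. a mod int m) \<in> hom integer_group (integer_mod_group m)"
    using m by (auto simp: hom_def carrier_integer_mod_group mod_add_eq)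
  show "(\<lambda>a. a mod int m) ` word_image integer_group n u \<subseteq> word_image (integer_mod_group m) n u"
    by (rule hom_word_image[OF group_integer_group group_integer_mod_group hom u])
  show "word_image (integer_mod_group m) n u \<subseteq> (\<lambda>a. a mod int m) ` word_image integer_group n u"
  proof
    fix y assume "y \<in> word_image (integer_mod_group m) n u"
    then obtain g where g: "g \<in> {..<n} \<rightarrow> carrier (integer_mod_group m)"
      and y: "y = word_eval (integer_mod_group m) g u"
      by (auto simp: word_image_def)
    \<comment> \<open>Residues are themselves integers, so \<open>g\<close> is its own lift. Beyond
      \<open>n\<close> it is arbitrary, but \<open>u\<close> has no such letters.\<close>
    have agree: "g i mod int m = g i" if "i < n" for i
    proof -
      have "g i \<in> {0..<int m}"
        using g m that by (auto simp: carrier_integer_mod_group Pi_iff)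
      then show ?thesis
        by simp
    qed
    have "word_eval (integer_mod_group m) g u = word_eval (integer_mod_group m) ((\<lambda>a. a mod int m) \<circ> g) u"
      using u by (intro word_eval_cong) (auto simp: carrier_free_group agree)
    also have "\<dots> = word_eval integer_group g u mod int m"
      using hom_word_eval[OF group_integer_group group_integer_mod_group hom, of g n u] u
      by (simp add: carrier_free_group)
    finally show "y \<in> (\<lambda>a. a mod int m) ` word_image integer_group n u"
      using y by (auto simp: word_image_def)
  qed
qed

lemma surjective_word_if_same_finite_images:
  assumes u: "u \<in> carrier (free_group n)" and w: "w \<in> carrier (free_group n)"
    and surj: "surjective_word n w" and same: "same_finite_word_images n u w"
  shows "surjective_word n u"
proof (rule surjective_word_if_one_in_image[OF u])
  let ?A = "word_image integer_group n u"
  \<comment> \<open>Writing \<open>1 mod int m\<close> instead of 1 keeps \<open>m = 1\<close>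
    valid, which is needed below when \<open>\<bar>a\<bar> = 1\<close>.\<close>
  have residues: "\<exists>b \<in> ?A. b mod int m = 1 mod int m" if m: "m > 0" for m
  proof -
    have fin: "finite (carrier (integer_mod_group m))"
      using m by (simp add: carrier_integer_mod_group)
    have "(\<lambda>a. a mod int m) ` ?A = carrier (integer_mod_group m)"
      using same_finite_word_imagesD[OF u w same group_integer_mod_group fin]
        surjective_wordD[OF w surj group_integer_mod_group[of m]]
        word_image_integer_mod_group[OF u m] by simp
    moreover have "1 mod int m \<in> carrier (integer_mod_group m)"
      using m by (simp add: carrier_integer_mod_group)
    ultimately show ?thesis
      by (metis (no_types, lifting) imageE)
  qed
  obtain a where a: "a \<in> ?A" "a \<noteq> 0"
    using residues[of 2] by (metis mod_0 of_nat_numeral one_mod_two_eq_one zero_less_numeral zero_neq_one)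
  then obtain b where b: "b \<in> ?A" "b mod \<bar>a\<bar> = 1 mod \<bar>a\<bar>"
    using residues[of "nat \<bar>a\<bar>"] by auto
  then have "a dvd 1 - b"
    by (metis abs_dvd_iff mod_eq_dvd_iff)
  then obtain k where "1 = k * a + 1 * b"
    by (metis dvdE diff_eq_eq mult.commute mult_1)
  then show "1 \<in> ?A"
    using word_image_integer_group_linear[OF a(1) b(1), of k 1] by simp
qed

text \<open>A substitution \<open>g\<close> with value \<open>v\<close> at \<open>w\<close> is
  already an endomorphism: the one sending generator \<open>i\<close> to \<open>g i\<close>.\<close>

lemma surjective_word_endomorphism:
  assumes w: "w \<in> carrier (free_group n)" and surj: "surjective_word n w"
    and v: "v \<in> carrier (free_group n)"
  shows "\<exists>\<phi> \<in> hom (free_group n) (free_group n). \<phi> w = v"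
proof -
  obtain g where "g \<in> {..<n} \<rightarrow> carrier (free_group n)" "v = word_eval (free_group n) g w"
    using surjective_wordD[OF w surj group_free_group, of n] v unfolding word_image_def by blast
  then show ?thesis
    using word_eval_hom[OF group_free_group] by blast
qed

theorem theorem4p4:
  fixes n :: nat and w :: "letter list"
  assumes "w \<in> carrier (free_group n)"
    and "surjective_word n w"
  shows "weakly_profinitely_rigid n w"
  unfolding weakly_profinitely_rigid_def endomorphic_equivalent_def
  \<comment> \<open>Once \<open>u\<close> is known to be surjective, the endomorphism lemma applies
    in both directions.\<close>
  using surjective_word_endomorphism surjective_word_if_same_finite_images assms by meson

end
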